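(* Let $(\mathcal{X},d,\mu)$ be a space of homogeneous type with upper dimension $\omega$, and let $\theta\in(0,1/\omega]$, $\beta\in[\theta\omega,1]$, and $\gamma\in(0,\infty)$. Then there exists a positive constant $C$ such that, for any $\psi\in\mathcal{G}(\beta,\gamma)$ and $f\in\mathrm{lip}_\theta(\mathcal{X})$, $$\|\psi f\|_{\mathrm{lip}_\theta(\mathcal{X})}\le C\|\psi\|_{\mathcal{G}(\beta,\gamma)}\|f\|_{\mathrm{lip}_\theta(\mathcal{X})}.$$
   Context: **Space of homogeneous type.** $\mathcal{X}$ is a non-empty set, $d:\mathcal{X}\times\mathcal{X}\to[0,\infty)$ satisfies $d(x,y)=0\iff x=y$, $d(x,y)=d(y,x)$, and $d(x,z)\le A_0[d(x,y)+d(y,z)]$ for a constant $A_0\in[1,\infty)$; $\mu$ is a measure on $\mathcal{X}$ such that $\mu(2B)\le C\mu(B)$ for all balls $B=B(x_B,r_B):=\{x:d(x_B,x)<r_B\}$, where $\tau B:=B(x_B,\tau r_B)$. Standing assumptions: $\mu(\mathcal{X})=\infty$; for each $x$ the balls $\{B(x,r)\}_{r>0}$ form a basis of open neighborhoods of $x$; $\mu$ is Borel regular (open sets are measurable and every set $A$ lies in a Borel set $E$ with $\mu(A)=\mu(E)$); $\mu(B(x,r))\in(0,\infty)$ and $\mu(\{x\})=0$ for all $x$ and $r>0$. Put $C_{(\mu)}:=\sup_B\mu(2B)/\mu(B)$; the upper dimension is $\omega:=\log_2C_{(\mu)}$, so $\mu(\lambda B)\le C_{(\mu)}\lambda^\omega\mu(B)$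 for $\lambda\ge1$. Write $V_r(x):=\mu(B(x,r))$ and $V(x,y):=\mu(B(x,d(x,y)))$ (with $V(x,x):=0$). **Inhomogeneous Lipschitz space.** $L^q_{\mathcal{B}}(\mathcal{X})$ ($q\in[1,\infty]$) is the set of measurable $f$ with $f\mathbf{1}_B\in L^q(\mathcal{X})$ for every ball $B$. For $\theta>0$ and a ball $B$ of radius $r_B$, let $\mathcal{M}^B_\theta(f):=\sup_{x,y\in B}|f(x)-f(y)|/[\mu(B)]^\theta$ if $r_B\in(0,1]$ and $\mathcal{M}^B_\theta(f):=\|f\|_{L^\infty(B)}/[\mu(B)]^\theta$ if $r_B\in(1,\infty)$. Then $\mathrm{lip}_\theta(\mathcal{X}):=\{f\in L^q_{\mathcal{B}}(\mathcal{X}):\|f\|_{\mathrm{lip}_\theta(\mathcal{X})}:=\sup_B\mathcal{M}^B_\theta(f)<\infty\}$ (the choice of $q$ is immaterial). **Test functions.** Put $P_\gamma(x,y;r):=\frac{1}{V_r(x)+V(x,y)}\left[\frac{r}{r+d(x,y)}\right]^\gamma$. For $x_0\in\mathcal{X}$, $r,\gamma\in(0,\infty)$, $\beta\in(0,1]$, $\mathcal{G}(x_0,r,\beta,\gamma)$ is the set of measurable $f$ for which there is $C>0$ with (a) $|f(x)|\le CP_\gamma(x_0,x;r)$ for all $x$; (b) $|f(x)-f(y)|\le C\left[\frac{d(x,y)}{r+d(x_0,x)}\right]^\beta P_\gamma(x_0,x;r)$ whenever $d(x,y)\le(2A_0)^{-1}[r+d(x_0,x)]$; its norm is the infimum of such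 $C$. Fix a point $x_0\in\mathcal{X}$ once and for all and write $\mathcal{G}(\beta,\gamma):=\mathcal{G}(x_0,1,\beta,\gamma)$; constants may depend on $x_0$. *)

theory Defs
  imports "HOL-Probability.Essential_Supremum"
begin

definition qball :: "('a \<Rightarrow> 'a \<Rightarrow> real) \<Rightarrow> 'a \<Rightarrow> real \<Rightarrow> 'a set" where
  "qball d x r = {y. d x y < r}"

text \<open>
  The only topology on the whole type for which the balls centred at each point can be a
  neighbourhood basis. For a quasi-metric, balls need not be open in it; that is part of the
  assumptions on a space of homogeneous type below.
\<close>
definition qtopology :: "('a \<Rightarrow> 'a \<Rightarrow> real) \<Rightarrow> 'a topology" where
  "qtopology d = topology (\<lambda>U. \<forall>x\<in>U. \<exists>r>0. qball d x r \<subseteq> U)"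

lemma istopology_qtopology:
  "istopology (\<lambda>U. \<forall>x\<in>U. \<exists>r>0. qball d x r \<subseteq> U)"
  unfolding istopology_def
proof (intro conjI allI impI ballI)
  fix S T x
  assume S: "\<forall>x\<in>S. \<exists>r>0. qball d x r \<subseteq> S" and T: "\<forall>x\<in>T. \<exists>r>0. qball d x r \<subseteq> T"
    and x: "x \<in> S \<inter> T"
  obtain r s where "r > 0" "qball d x r \<subseteq> S" "s > 0" "qball d x s \<subseteq> T"
    using S T x by blast
  then show "\<exists>r>0. qball d x r \<subseteq> S \<inter> T"
    by (intro exI[of _ "min r s"]) (auto simp: qball_def)
next
  fix K x
  assume K: "\<forall>S\<in>K. \<forall>x\<in>S. \<exists>r>0. qball d x r \<subseteq> S" and x: "x \<in> \<Union>K"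
  obtain S where "S \<in> K" "x \<in> S" using x by blast
  with K obtain r where "r > 0" "qball d x r \<subseteq> S" by blast
  with \<open>S \<in> K\<close> show "\<exists>r>0. qball d x r \<subseteq> \<Union>K" by blast
qed

lemma openin_qtopology:
  "openin (qtopology d) U \<longleftrightarrow> (\<forall>x\<in>U. \<exists>r>0. qball d x r \<subseteq> U)"
  by (simp add: qtopology_def istopology_qtopology topology_inverse')

text \<open>
  The underlying set is the whole type. The measure of an arbitrary set, which occurs in
  Borel regularity, is the outer measure induced by \<open>M\<close>; the sigma-algebra of \<open>M\<close> may be
  larger than the Borel one.
\<close>
locale homogeneous_type_space =
  fixes d :: "'a \<Rightarrow> 'a \<Rightarrow> real" and A0 :: real and M :: "'a measure"
  assumes d_nonneg: "0 \<le> d x y"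
    and d_eq_0_iff: "d x y = 0 \<longleftrightarrow> x = y"
    and d_commute: "d x y = d y x"
    and A0_ge_1: "1 \<le> A0"
    and d_quasi_triangle: "d x z \<le> A0 * (d x y + d y z)"
    and space_eq_UNIV: "space M = UNIV"
    and doubling: "\<exists>C::real. \<forall>x. \<forall>r>0.
      emeasure M (qball d x (2 * r)) \<le> ennreal C * emeasure M (qball d x r)"
    and infinite_measure: "emeasure M UNIV = \<infinity>"
    and open_qball: "0 < r \<Longrightarrow> openin (qtopology d) (qball d x r)"
    and open_measurable: "openin (qtopology d) U \<Longrightarrow> U \<in> sets M"
    and borel_regular: "\<exists>E \<in> sigma_sets UNIV {U. openin (qtopology d) U}.
      A \<subseteq> E \<and> outer_measure_of M A = emeasure M E"
    and qball_measure_pos: "0 < r \<Longrightarrow> 0 < emeasure M (qball d x r)"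
    and qball_measure_finite: "0 < r \<Longrightarrow> emeasure M (qball d x r) < \<infinity>"
    and singleton_null: "emeasure M {x} = 0"

definition doubling_constant :: "('a \<Rightarrow> 'a \<Rightarrow> real) \<Rightarrow> 'a measure \<Rightarrow> real" where
  "doubling_constant d M =
    (SUP (x, r)\<in>UNIV \<times> {0<..}. measure M (qball d x (2 * r)) / measure M (qball d x r))"

definition upper_dimension :: "('a \<Rightarrow> 'a \<Rightarrow> real) \<Rightarrow> 'a measure \<Rightarrow> real" where
  "upper_dimension d M = log 2 (doubling_constant d M)"

definition Linf_norm :: "'a measure \<Rightarrow> ('a \<Rightarrow> complex) \<Rightarrow> ennreal" where
  "Linf_norm M f = esssup M (\<lambda>x. ennreal (cmod (f x)))"

definition Lq_space :: "'a measure \<Rightarrow> ennreal \<Rightarrow> ('a \<Rightarrow> complex) set" where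
  "Lq_space M q = {f \<in> borel_measurable M.
    if q = \<infinity> then Linf_norm M f < \<infinity>
    else integrable M (\<lambda>x. cmod (f x) powr enn2real q)}"

definition Lq_ball_space ::
    "('a \<Rightarrow> 'a \<Rightarrow> real) \<Rightarrow> 'a measure \<Rightarrow> ennreal \<Rightarrow> ('a \<Rightarrow> complex) set" where
  "Lq_ball_space d M q = {f \<in> borel_measurable M.
    \<forall>x. \<forall>r>0. (\<lambda>y. f y * indicator (qball d x r) y) \<in> Lq_space M q}"

text \<open>
  A ball enters through its centre and radius, since a set may be a ball for several radii.
\<close>
definition lip_ball_quantity ::
    "('a \<Rightarrow> 'a \<Rightarrow> real) \<Rightarrow> 'a measure \<Rightarrow> real \<Rightarrow> ('a \<Rightarrow> complex) \<Rightarrow> 'a \<Rightarrow> real \<Rightarrow> ennreal" where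
  "lip_ball_quantity d M \<theta> f z r =
    (if r \<le> 1 then (SUP x\<in>qball d z r. SUP y\<in>qball d z r. ennreal (cmod (f x - f y)))
     else Linf_norm (restrict_space M (qball d z r)) f)
    / ennreal (measure M (qball d z r) powr \<theta>)"

definition lip_norm ::
    "('a \<Rightarrow> 'a \<Rightarrow> real) \<Rightarrow> 'a measure \<Rightarrow> real \<Rightarrow> ('a \<Rightarrow> complex) \<Rightarrow> ennreal" where
  "lip_norm d M \<theta> f = (SUP (z, r)\<in>UNIV \<times> {0<..}. lip_ball_quantity d M \<theta> f z r)"

definition lip_space ::
    "('a \<Rightarrow> 'a \<Rightarrow> real) \<Rightarrow> 'a measure \<Rightarrow> ennreal \<Rightarrow> real \<Rightarrow> ('a \<Rightarrow> complex) set" where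
  "lip_space d M q \<theta> = {f \<in> Lq_ball_space d M q. lip_norm d M \<theta> f < \<infinity>}"

definition P_kernel ::
    "('a \<Rightarrow> 'a \<Rightarrow> real) \<Rightarrow> 'a measure \<Rightarrow> real \<Rightarrow> 'a \<Rightarrow> 'a \<Rightarrow> real \<Rightarrow> real" where
  "P_kernel d M \<gamma> x y r =
    1 / (measure M (qball d x r) + measure M (qball d x (d x y))) * (r / (r + d x y)) powr \<gamma>"

definition test_bound :: "('a \<Rightarrow> 'a \<Rightarrow> real) \<Rightarrow> real \<Rightarrow> 'a measure \<Rightarrow>
    'a \<Rightarrow> real \<Rightarrow> real \<Rightarrow> real \<Rightarrow> ('a \<Rightarrow> complex) \<Rightarrow> real \<Rightarrow> bool" where
  "test_bound d A0 M x0 r \<beta> \<gamma> f C \<longleftrightarrow>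
    (\<forall>x. cmod (f x) \<le> C * P_kernel d M \<gamma> x0 x r) \<and>
    (\<forall>x y. d x y \<le> (r + d x0 x) / (2 * A0) \<longrightarrow>
      cmod (f x - f y) \<le> C * (d x y / (r + d x0 x)) powr \<beta> * P_kernel d M \<gamma> x0 x r)"

definition test_space :: "('a \<Rightarrow> 'a \<Rightarrow> real) \<Rightarrow> real \<Rightarrow> 'a measure \<Rightarrow>
    'a \<Rightarrow> real \<Rightarrow> real \<Rightarrow> real \<Rightarrow> ('a \<Rightarrow> complex) set" where
  "test_space d A0 M x0 r \<beta> \<gamma> =
    {f \<in> borel_measurable M. \<exists>C>0. test_bound d A0 M x0 r \<beta> \<gamma> f C}"

definition test_norm :: "('a \<Rightarrow> 'a \<Rightarrow> real) \<Rightarrow> real \<Rightarrow> 'a measure \<Rightarrow>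
    'a \<Rightarrow> real \<Rightarrow> real \<Rightarrow> real \<Rightarrow> ('a \<Rightarrow> complex) \<Rightarrow> real" where
  "test_norm d A0 M x0 r \<beta> \<gamma> f = Inf {C. C > 0 \<and> test_bound d A0 M x0 r \<beta> \<gamma> f C}"

end

(* For f in the Lipschitz space with norm N, comparing f(x) with the values of f at almost
   every point of B(x,1), which are controlled by the L-infinity condition on B(x,2), gives
   |f(x)| <= (1 + D^theta) N mu(B(x,1))^theta everywhere, where D is the doubling constant.
   On a ball B = B(z,r) with r <= 1 write
     psi(x) f(x) - psi(y) f(y) = psi(x) (f(x) - f(y)) + f(y) (psi(x) - psi(y)).
   The Hoelder condition with beta >= theta omega makes psi(x) - psi(y) of order
   r^(theta omega), while mu(B(y,1))^theta is at most of order r^(-theta omega) mu(B)^theta by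
   doubling: the powers of r cancel in the second term. *)
theory Submission
  imports Defs
begin

context homogeneous_type_space
begin

section \<open>Volumes of balls, doubling and the upper dimension\<close>

abbreviation V :: "'a \<Rightarrow> real \<Rightarrow> real" where
  "V x r \<equiv> measure M (qball d x r)"

abbreviation D :: real where
  "D \<equiv> doubling_constant d M"

abbreviation \<omega> :: real where
  "\<omega> \<equiv> upper_dimension d M"

lemma qball_sets [measurable, simp]: "qball d x r \<in> sets M"
proof (cases "r > 0")
  case True
  then show ?thesis by (intro open_measurable open_qball)
next
  case False
  then have "qball d x r = {}"
    using d_nonneg[of x] by (auto simp: qball_def not_less intro: order_trans)
  then show ?thesis by simp
qed

lemma emeasure_qball: "0 < r \<Longrightarrow> emeasure M (qball d x r) = ennreal (V x r)"
  using qball_measure_finite[of r x] by (intro emeasure_eq_ennreal_measure) auto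

lemma V_pos: "0 < r \<Longrightarrow> 0 < V x r"
  using qball_measure_pos[of r x] by (simp add: emeasure_qball)

lemma V_mono:
  assumes "qball d x r \<subseteq> qball d y s" and "0 < s"
  shows "V x r \<le> V y s"
proof (rule measure_mono_fmeasurable[OF assms(1)])
  show "qball d y s \<in> fmeasurable M"
    using qball_measure_finite[OF \<open>0 < s\<close>] by (simp add: fmeasurable_def)
qed simp

text \<open>A supremum of reals dominates its members only if they are bounded above; the constant
  in \<open>doubling\<close> supplies that bound on the ratios defining \<open>D\<close>.\<close>

lemma V_double:
  assumes "0 < r"
  shows "V x (2 * r) \<le> D * V x r"
proof -
  obtain C :: real where C: "\<And>x r. r > 0 \<Longrightarrow>
      emeasure M (qball d x (2 * r)) \<le> ennreal C * emeasure M (qball d x r)"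
    using doubling by blast
  \<comment> \<open>\<open>C\<close> is not assumed nonnegative and \<open>ennreal\<close> truncates
    at 0, so the usable real constant is \<open>max C 0\<close>.\<close>
  have ratio: "V y (2 * s) / V y s \<le> max C 0" if s: "s > 0" for y s
  proof -
    have "ennreal C = ennreal (max C 0)"
      by (cases "C \<ge> 0") (auto simp: max_def ennreal_neg)
    then have "ennreal (V y (2 * s)) \<le> ennreal (max C 0 * V y s)"
      using C[of s y] s by (simp add: emeasure_qball ennreal_mult)
    then have "V y (2 * s) \<le> max C 0 * V y s"
      by (subst (asm) ennreal_le_iff) auto
    then show ?thesis using V_pos[OF s, of y] by (simp add: pos_divide_le_eq)
  qed
  have "V x (2 * r) / V x r \<le> D"
    unfolding doubling_constant_def
    by (rule cSUP_upper2[where x = "(x, r)"])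
      (use assms ratio in \<open>auto intro!: bdd_aboveI[where M = "max C 0"]\<close>)
  then show ?thesis using V_pos[OF assms, of x] by (simp add: pos_divide_le_eq)
qed

text \<open>Gives the logarithm defining \<open>\<omega>\<close> its meaning: it yields
  \<open>D = 2 powr \<omega>\<close> and \<open>\<omega>\<close> nonnegative.\<close>

lemma D_ge_1: "1 \<le> D"
proof -
  fix x
  have "V x 1 \<le> V x (2 * 1)" by (rule V_mono) (auto simp: qball_def)
  also have "\<dots> \<le> D * V x 1" by (rule V_double) simp
  finally show ?thesis using V_pos[of 1 x] by simp
qed

lemma upper_dimension_nonneg: "0 \<le> \<omega>"
  using D_ge_1 by (simp add: upper_dimension_def)

lemma V_scale:
  assumes "0 < r" and "1 \<le> l"
  shows "V x (l * r) \<le> D * l powr \<omega> * V x r"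
proof -
  have pow: "V x (2 ^ n * r) \<le> D ^ n * V x r" for n
  proof (induction n)
    case (Suc n)
    have "V x (2 ^ Suc n * r) = V x (2 * (2 ^ n * r))" by (simp add: mult.assoc)
    also have "\<dots> \<le> D * V x (2 ^ n * r)" using assms by (intro V_double) simp
    also have "\<dots> \<le> D * (D ^ n * V x r)" using Suc D_ge_1 by (intro mult_left_mono) auto
    finally show ?case by (simp add: mult_ac)
  qed simp
  \<comment> \<open>\<open>l\<close> lies between \<open>2 ^ n\<close> and \<open>2 ^ Suc n\<close>.
    Of the \<open>Suc n\<close> doublings, \<open>n\<close> are absorbed by
    \<open>l powr \<omega>\<close>; the last one leaves the factor \<open>D\<close>.\<close>
  define n where "n = nat \<lfloor>log 2 l\<rfloor>"
  have n: "real n \<le> log 2 l" "log 2 l \<le> real (Suc n)"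
    using assms by (simp_all add: n_def) linarith
  have "D = 2 powr \<omega>" using D_ge_1 by (simp add: upper_dimension_def)
  then have "D ^ n = (2 powr real n) powr \<omega>"
    using D_ge_1 by (simp add: powr_realpow[symmetric] powr_powr mult.commute)
  also have "\<dots> \<le> l powr \<omega>"
  proof (rule powr_mono2)
    show "2 powr real n \<le> l" using n(1) assms by (simp add: le_log_iff)
  qed (use upper_dimension_nonneg in auto)
  finally have Dn: "D ^ n \<le> l powr \<omega>" .
  have "l \<le> 2 powr real (Suc n)" using n(2) assms by (simp add: log_le_iff)
  then have "l \<le> 2 ^ Suc n" by (simp only: powr_realpow)
  then have lr: "l * r \<le> 2 ^ Suc n * r" using assms by (intro mult_right_mono) auto
  have "V x (l * r) \<le> V x (2 ^ Suc n * r)"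
  proof (rule V_mono)
    show "qball d x (l * r) \<subseteq> qball d x (2 ^ Suc n * r)"
      unfolding qball_def using lr by (blast intro: less_le_trans)
  qed (use assms in simp)
  also have "\<dots> \<le> D ^ Suc n * V x r" by (rule pow)
  also have "\<dots> = D * D ^ n * V x r" by simp
  also have "\<dots> \<le> D * l powr \<omega> * V x r"
    using D_ge_1 Dn by (intro mult_mono mult_left_mono) auto
  finally show ?thesis .
qed

lemma dist_qball_less:
  assumes "x \<in> qball d z r" and "y \<in> qball d z r"
  shows "d x y < 2 * A0 * r"
proof -
  have "d x y \<le> A0 * (d x z + d z y)" by (rule d_quasi_triangle)
  also have "\<dots> < A0 * (r + r)"
    using assms A0_ge_1 by (intro mult_strict_left_mono add_strict_mono)
      (auto simp: qball_def d_commute[of x z])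
  finally show ?thesis by simp
qed

text \<open>The unit ball about \<open>y\<close> lies in the ball of radius \<open>2 * A0\<close>
  about \<open>z\<close>, the dilate of the small ball by \<open>2 * A0 / r\<close>, which is at
  least 1. This turns bounds in terms of \<open>V y 1\<close> into bounds in terms of
  \<open>V z r\<close>, at the price of \<open>r powr (- \<omega>)\<close>.\<close>

lemma V_unit_le:
  assumes "0 < r" and "r \<le> 1" and "y \<in> qball d z r"
  shows "V y 1 \<le> D * (2 * A0 / r) powr \<omega> * V z r"
proof -
  have "qball d y 1 \<subseteq> qball d z (2 * A0)"
  proof
    fix w assume w: "w \<in> qball d y 1"
    have "d z w \<le> A0 * (d z y + d y w)" by (rule d_quasi_triangle)
    also have "\<dots> < A0 * (1 + 1)"
      using assms w A0_ge_1 by (intro mult_strict_left_mono add_strict_mono) (auto simp: qball_def)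
    finally show "w \<in> qball d z (2 * A0)" by (simp add: qball_def)
  qed
  then have "V y 1 \<le> V z (2 * A0)" using A0_ge_1 by (intro V_mono) auto
  also have "\<dots> = V z (2 * A0 / r * r)" using assms by simp
  also have "\<dots> \<le> D * (2 * A0 / r) powr \<omega> * V z r"
    using assms A0_ge_1 by (intro V_scale) (auto simp: field_simps)
  finally show ?thesis .
qed

section \<open>Real-valued estimates equivalent to a bound on the Lipschitz norm\<close>

lemma lip_numerator_le:
  assumes "lip_norm d M \<theta> f < \<infinity>" and "0 < r"
  shows "(if r \<le> 1 then (SUP x\<in>qball d z r. SUP y\<in>qball d z r. ennreal (cmod (f x - f y)))
     else Linf_norm (restrict_space M (qball d z r)) f)
    \<le> ennreal (enn2real (lip_norm d M \<theta> f) * V z r powr \<theta>)" (is "?L \<le> _")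
proof -
  let ?v = "ennreal (V z r powr \<theta>)"
  \<comment> \<open>Division in \<open>ennreal\<close> can be undone only by a factor that is
    neither 0 nor \<open>top\<close>.\<close>
  have v: "?v \<noteq> 0" "?v < top" using V_pos[OF \<open>0 < r\<close>, of z] by auto
  have "?L / ?v \<le> lip_norm d M \<theta> f"
    unfolding lip_norm_def
    by (rule SUP_upper2[where i = "(z, r)"]) (use assms in \<open>auto simp: lip_ball_quantity_def\<close>)
  then have "?L / ?v * ?v \<le> lip_norm d M \<theta> f * ?v" by (intro mult_right_mono) auto
  also have "?L / ?v * ?v = ?L"
    using v by (simp add: ennreal_divide_times)
  also have "lip_norm d M \<theta> f = ennreal (enn2real (lip_norm d M \<theta> f))"
    using assms by simp
  finally show ?thesis by (simp add: ennreal_mult)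
qed

lemma lip_oscillation:
  assumes "lip_norm d M \<theta> f < \<infinity>" and "0 < r" and "r \<le> 1"
    and "x \<in> qball d z r" and "y \<in> qball d z r"
  shows "cmod (f x - f y) \<le> enn2real (lip_norm d M \<theta> f) * V z r powr \<theta>"
proof -
  have "ennreal (cmod (f x - f y)) \<le> (SUP x\<in>qball d z r. SUP y\<in>qball d z r. ennreal (cmod (f x - f y)))"
    using assms by (intro SUP_upper2[of x] SUP_upper2[of y]) auto
  also have "\<dots> \<le> ennreal (enn2real (lip_norm d M \<theta> f) * V z r powr \<theta>)"
    using lip_numerator_le[OF assms(1,2), of z] assms(3) by simp
  finally show ?thesis by (subst (asm) ennreal_le_iff) auto
qed

lemma lip_AE_bound:
  assumes "lip_norm d M \<theta> f < \<infinity>" and "1 < r"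
  shows "AE x in M. x \<in> qball d z r \<longrightarrow> cmod (f x) \<le> enn2real (lip_norm d M \<theta> f) * V z r powr \<theta>"
proof -
  let ?R = "restrict_space M (qball d z r)"
  have "AE x in ?R. ennreal (cmod (f x)) \<le> Linf_norm ?R f"
    unfolding Linf_norm_def by (rule esssup_AE)
  moreover have "Linf_norm ?R f \<le> ennreal (enn2real (lip_norm d M \<theta> f) * V z r powr \<theta>)"
    using lip_numerator_le[OF assms(1), of r z] assms(2) by simp
  ultimately have "AE x in ?R. cmod (f x) \<le> enn2real (lip_norm d M \<theta> f) * V z r powr \<theta>"
    by (elim eventually_mono) (metis order_trans ennreal_le_iff enn2real_nonneg powr_ge_zero mult_nonneg_nonneg)
  then show ?thesis by (subst (asm) AE_restrict_space_iff) (auto simp: space_eq_UNIV)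
qed

text \<open>The bound must hold at every point, since oscillation on small balls is a true supremum
  and an almost-everywhere bound on \<open>f y\<close> would not control it. The summand 1 comes
  from the oscillation on the unit ball, \<open>D powr \<theta>\<close> from replacing
  \<open>V x 2\<close> by \<open>V x 1\<close>.\<close>

lemma lip_pointwise_bound:
  assumes "lip_norm d M \<theta> f < \<infinity>" and "0 < \<theta>"
  shows "cmod (f x) \<le> (1 + D powr \<theta>) * enn2real (lip_norm d M \<theta> f) * V x 1 powr \<theta>"
proof -
  let ?N = "enn2real (lip_norm d M \<theta> f)"
  \<comment> \<open>Radius 2 is used because the norm controls the size of \<open>f\<close> only on
    balls of radius greater than 1.\<close>
  let ?P = "\<lambda>y. y \<in> qball d x 2 \<longrightarrow> cmod (f y) \<le> ?N * V x 2 powr \<theta>"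
  \<comment> \<open>The exceptional null set cannot cover the unit ball, whose measure is
    positive.\<close>
  have "\<exists>y\<in>qball d x 1. ?P y"
  proof (rule ccontr)
    assume "\<not> (\<exists>y\<in>qball d x 1. ?P y)"
    moreover have "AE y in M. ?P y" using assms by (intro lip_AE_bound) auto
    ultimately have "AE y in M. y \<notin> qball d x 1" by (auto elim: eventually_mono)
    then have "emeasure M (qball d x 1) = 0"
      by (simp add: AE_iff_null_sets[symmetric] null_sets_def)
    then show False using qball_measure_pos[of 1 x] by simp
  qed
  then obtain y where y: "y \<in> qball d x 1" "?P y" by blast
  then have fy: "cmod (f y) \<le> ?N * V x 2 powr \<theta>" by (auto simp: qball_def)
  have "V x 2 powr \<theta> \<le> (D * V x 1) powr \<theta>"
    using V_double[of 1 x] assms by (intro powr_mono2) auto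
  then have V2: "V x 2 powr \<theta> \<le> D powr \<theta> * V x 1 powr \<theta>"
    using D_ge_1 by (simp add: powr_mult)
  have "x \<in> qball d x 1" by (simp add: qball_def d_eq_0_iff[THEN iffD2])
  then have "cmod (f x - f y) \<le> ?N * V x 1 powr \<theta>"
    using assms y by (intro lip_oscillation) auto
  moreover have "cmod (f x) \<le> cmod (f x - f y) + cmod (f y)"
    by (metis diff_add_cancel norm_triangle_ineq)
  moreover have "?N * V x 2 powr \<theta> \<le> ?N * (D powr \<theta> * V x 1 powr \<theta>)"
    using V2 by (intro mult_left_mono) auto
  ultimately show ?thesis using fy by (simp add: algebra_simps)
qed

text \<open>Converse to \<open>lip_oscillation\<close> and \<open>lip_AE_bound\<close>: one real
  constant serving both ranges of radii bounds the norm once the positive finite denominator is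
  divided out.\<close>

lemma lip_norm_leI:
  assumes g: "g \<in> borel_measurable M" and "0 \<le> K"
    and small: "\<And>z r x y. 0 < r \<Longrightarrow> r \<le> 1 \<Longrightarrow> x \<in> qball d z r \<Longrightarrow> y \<in> qball d z r \<Longrightarrow>
      cmod (g x - g y) \<le> K * V z r powr \<theta>"
    and large: "\<And>z r. 1 < r \<Longrightarrow> AE x in M. x \<in> qball d z r \<longrightarrow> cmod (g x) \<le> K * V z r powr \<theta>"
  shows "lip_norm d M \<theta> g \<le> ennreal K"
  unfolding lip_norm_def
proof (rule SUP_least, clarsimp)
  fix z and r :: real assume "0 < r"
  have "(if r \<le> 1 then (SUP x\<in>qball d z r. SUP y\<in>qball d z r. ennreal (cmod (g x - g y)))
     else Linf_norm (restrict_space M (qball d z r)) g) \<le> ennreal (K * V z r powr \<theta>)"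
  proof (cases "r \<le> 1")
    case True
    then show ?thesis
      using small \<open>0 < r\<close> by (auto intro!: SUP_least ennreal_leI)
  next
    case False
    have "AE x in restrict_space M (qball d z r). cmod (g x) \<le> K * V z r powr \<theta>"
      using large[of r z] False by (subst AE_restrict_space_iff) (auto simp: space_eq_UNIV)
    \<comment> \<open>Measurability of \<open>g\<close> matters here: \<open>esssup\<close> of a
      nonmeasurable function is \<open>top\<close>.\<close>
    then have "Linf_norm (restrict_space M (qball d z r)) g \<le> ennreal (K * V z r powr \<theta>)"
      unfolding Linf_norm_def
      by (intro esssup_I measurable_restrict_space1)
        (use g in \<open>auto elim!: eventually_mono intro: ennreal_leI\<close>)
    then show ?thesis using False by simp
  qed
  then show "lip_ball_quantity d M \<theta> g z r \<le> ennreal K"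
    unfolding lip_ball_quantity_def
    by (intro divide_le_posI_ennreal)
      (use V_pos[OF \<open>0 < r\<close>, of z] \<open>0 \<le> K\<close> in \<open>auto simp: ennreal_mult' mult.commute\<close>)
qed

section \<open>Integrability of products with a bounded factor\<close>

lemma Lq_space_mult_bounded:
  assumes h: "h \<in> Lq_space M q" and g: "g \<in> borel_measurable M"
    and bound: "\<And>x. cmod (g x) \<le> K"
  shows "(\<lambda>x. g x * h x) \<in> Lq_space M q"
proof -
  \<comment> \<open>Any point serves; \<open>undefined\<close> is merely one that every type
    provides.\<close>
  have K: "0 \<le> K" using bound[of undefined] norm_ge_zero order_trans by blast
  have hm [measurable]: "h \<in> borel_measurable M" using h by (simp add: Lq_space_def)
  note g [measurable]
  have le: "cmod (g x * h x) \<le> K * cmod (h x)" for x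
    using bound[of x] by (simp add: norm_mult mult_right_mono)
  show ?thesis
  proof (cases "q = \<infinity>")
    case True
    have fin: "Linf_norm M h < \<infinity>" using h True by (simp add: Lq_space_def)
    have "AE x in M. ennreal (cmod (h x)) \<le> Linf_norm M h"
      unfolding Linf_norm_def by (rule esssup_AE)
    then have "AE x in M. ennreal (cmod (g x * h x)) \<le> ennreal K * Linf_norm M h"
    proof (rule eventually_mono)
      fix x assume "ennreal (cmod (h x)) \<le> Linf_norm M h"
      then have "ennreal K * ennreal (cmod (h x)) \<le> ennreal K * Linf_norm M h"
        by (rule mult_left_mono) simp
      moreover have "ennreal (cmod (g x * h x)) \<le> ennreal K * ennreal (cmod (h x))"
        using le[of x] K by (simp add: ennreal_mult[symmetric] ennreal_leI)
      ultimately show "ennreal (cmod (g x * h x)) \<le> ennreal K * Linf_norm M h"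
        by (rule order_trans[rotated])
    qed
    then have "Linf_norm M (\<lambda>x. g x * h x) \<le> ennreal K * Linf_norm M h"
      unfolding Linf_norm_def[of M "\<lambda>x. g x * h x"] by (intro esssup_I) measurable
    also have "\<dots> < \<infinity>" using fin by (simp add: ennreal_mult_less_top)
    finally show ?thesis using True by (simp add: Lq_space_def)
  next
    case False
    then have "integrable M (\<lambda>x. cmod (h x) powr enn2real q)" using h by (simp add: Lq_space_def)
    then have "integrable M (\<lambda>x. K powr enn2real q * cmod (h x) powr enn2real q)" by simp
    then have "integrable M (\<lambda>x. cmod (g x * h x) powr enn2real q)"
    proof (rule Bochner_Integration.integrable_bound)
      show "AE x in M. norm (cmod (g x * h x) powr enn2real q)
          \<le> norm (K powr enn2real q * cmod (h x) powr enn2real q)"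
      proof (rule AE_I2)
        fix x
        have "cmod (g x * h x) powr enn2real q \<le> (K * cmod (h x)) powr enn2real q"
          using le by (intro powr_mono2) auto
        then show "norm (cmod (g x * h x) powr enn2real q)
          \<le> norm (K powr enn2real q * cmod (h x) powr enn2real q)"
          using K by (simp add: powr_mult)
      qed
    qed measurable
    then show ?thesis using False by (simp add: Lq_space_def)
  qed
qed

text \<open>Supplies the part of membership in \<open>lip_space\<close> that a bound on the
  Lipschitz norm does not state; the bounded factor will be the test function.\<close>

lemma Lq_ball_space_mult_bounded:
  assumes f: "f \<in> Lq_ball_space d M q" and g: "g \<in> borel_measurable M"
    and bound: "\<And>x. cmod (g x) \<le> K"
  shows "(\<lambda>x. g x * f x) \<in> Lq_ball_space d M q"
  using assms Lq_space_mult_bounded[OF _ g bound]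
  by (auto simp: Lq_ball_space_def mult.assoc)

section \<open>Size and oscillation of test functions\<close>

lemma P_kernel_pos: "0 < r \<Longrightarrow> 0 < P_kernel d M \<gamma> x0 x r"
  using V_pos[of r x0] d_nonneg[of x0 x]
  by (auto simp: P_kernel_def intro!: mult_pos_pos divide_pos_pos add_pos_nonneg)

text \<open>Dropping the second volume shrinks the denominator, and the decay factor is at most 1.
  Only this uniform bound is used later, so the final constant depends on \<open>x0\<close> through
  \<open>V x0 1\<close>.\<close>

lemma P_kernel_le:
  assumes "0 < r" and "0 < \<gamma>"
  shows "P_kernel d M \<gamma> x0 x r \<le> 1 / V x0 r"
proof -
  have "1 / (V x0 r + V x0 (d x0 x)) \<le> 1 / V x0 r"
    using V_pos[OF assms(1), of x0] by (intro divide_left_mono) (auto simp: add_pos_nonneg)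
  moreover have "(r / (r + d x0 x)) powr \<gamma> \<le> 1"
    using assms d_nonneg[of x0 x] by (intro powr_le1) auto
  moreover have "0 \<le> 1 / V x0 r" by simp
  ultimately show ?thesis
    unfolding P_kernel_def using mult_mono[of _ "1 / V x0 r" _ 1] by fastforce
qed

text \<open>The infimum defining the norm satisfies both test inequalities, because each has the
  form \<open>c \<le> C * a\<close> with \<open>a\<close> nonnegative and independent of
  \<open>C\<close>, a condition closed in \<open>C\<close>.\<close>

lemma test_norm_bound:
  assumes "\<psi> \<in> test_space d A0 M x0 r \<beta> \<gamma>"
  shows "test_bound d A0 M x0 r \<beta> \<gamma> \<psi> (test_norm d A0 M x0 r \<beta> \<gamma> \<psi>)"
    and "0 \<le> test_norm d A0 M x0 r \<beta> \<gamma> \<psi>"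
proof -
  let ?S = "{C. C > 0 \<and> test_bound d A0 M x0 r \<beta> \<gamma> \<psi> C}"
  have ne: "?S \<noteq> {}" using assms by (auto simp: test_space_def)
  show "0 \<le> test_norm d A0 M x0 r \<beta> \<gamma> \<psi>"
    unfolding test_norm_def by (rule cInf_greatest[OF ne]) auto
  \<comment> \<open>For positive \<open>a\<close>, \<open>c / a\<close> is a lower bound of the
    admissible constants. For \<open>a = 0\<close>, any single admissible constant shows
    \<open>c \<le> 0\<close>.\<close>
  have le: "c \<le> test_norm d A0 M x0 r \<beta> \<gamma> \<psi> * a"
    if "0 \<le> a" and all: "\<And>C. C \<in> ?S \<Longrightarrow> c \<le> C * a" for a c
  proof (cases "a = 0")
    case True
    then show ?thesis using ne all by auto
  next
    case False
    then have "0 < a" using that by simp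
    have "c / a \<le> test_norm d A0 M x0 r \<beta> \<gamma> \<psi>"
      unfolding test_norm_def
      by (rule cInf_greatest[OF ne]) (use all \<open>0 < a\<close> in \<open>auto simp: pos_divide_le_eq\<close>)
    then show ?thesis using \<open>0 < a\<close> by (simp add: pos_divide_le_eq)
  qed
  have P: "0 \<le> P_kernel d M \<gamma> x0 x r" for x
    by (auto simp: P_kernel_def)
  show "test_bound d A0 M x0 r \<beta> \<gamma> \<psi> (test_norm d A0 M x0 r \<beta> \<gamma> \<psi>)"
    unfolding test_bound_def mult.assoc
  proof (intro conjI allI impI)
    fix x
    show "cmod (\<psi> x) \<le> test_norm d A0 M x0 r \<beta> \<gamma> \<psi> * P_kernel d M \<gamma> x0 x r"
      by (rule le) (auto simp: P test_bound_def)
  next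
    fix x y assume "d x y \<le> (r + d x0 x) / (2 * A0)"
    then show "cmod (\<psi> x - \<psi> y) \<le> test_norm d A0 M x0 r \<beta> \<gamma> \<psi> *
        ((d x y / (r + d x0 x)) powr \<beta> * P_kernel d M \<gamma> x0 x r)"
      by (intro le) (auto simp: P test_bound_def mult.assoc)
  qed
qed

lemma test_bound_sup:
  assumes "test_bound d A0 M x0 1 \<beta> \<gamma> \<psi> t" and "0 \<le> t" and "0 < \<gamma>"
  shows "cmod (\<psi> x) \<le> t / V x0 1"
proof -
  have "cmod (\<psi> x) \<le> t * P_kernel d M \<gamma> x0 x 1" using assms by (simp add: test_bound_def)
  also have "\<dots> \<le> t * (1 / V x0 1)" using assms P_kernel_le by (intro mult_left_mono) auto
  finally show ?thesis by simp
qed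

text \<open>Extends the Hoelder estimate to all pairs in a small ball. For close pairs it follows
  from the regularity condition; for the others \<open>r\<close> is bounded below and the uniform
  bound on \<open>\<psi>\<close> suffices.\<close>

lemma test_bound_oscillation:
  assumes t: "test_bound d A0 M x0 1 \<beta> \<gamma> \<psi> t" "0 \<le> t" and "0 < \<gamma>"
    and \<alpha>: "0 \<le> \<alpha>" "\<alpha> \<le> \<beta>" "\<beta> \<le> 1"
    and r: "0 < r" "r \<le> 1" and xy: "x \<in> qball d z r" "y \<in> qball d z r"
  shows "cmod (\<psi> x - \<psi> y) \<le> 8 * A0\<^sup>2 * r powr \<alpha> * (t / V x0 1)"
proof (cases "d x y \<le> (1 + d x0 x) / (2 * A0)")
  case True
  have "d x y / (1 + d x0 x) \<le> d x y / 1"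
    using d_nonneg[of x y] d_nonneg[of x0 x] by (intro divide_left_mono) auto
  also have "\<dots> \<le> 2 * A0 * r" using dist_qball_less[OF xy] by simp
  finally have "(d x y / (1 + d x0 x)) powr \<beta> \<le> (2 * A0 * r) powr \<beta>"
    using \<alpha> d_nonneg by (intro powr_mono2) (auto simp: add_nonneg_nonneg)
  also have "\<dots> = (2 * A0) powr \<beta> * r powr \<beta>" using A0_ge_1 r by (simp add: powr_mult)
  \<comment> \<open>The base \<open>2 * A0\<close> exceeds 1, so its exponent may rise to 1;
    \<open>r\<close> is at most 1, so its exponent may drop to \<open>\<alpha>\<close>.\<close>
  also have "\<dots> \<le> (2 * A0) powr 1 * r powr \<alpha>"
    using A0_ge_1 \<alpha> r by (intro mult_mono powr_mono powr_mono') auto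
  also have "\<dots> \<le> 8 * A0\<^sup>2 * r powr \<alpha>"
    using A0_ge_1 mult_mono[of 1 A0 1 A0] by (intro mult_right_mono) (auto simp: power2_eq_square)
  finally have *: "(d x y / (1 + d x0 x)) powr \<beta> \<le> 8 * A0\<^sup>2 * r powr \<alpha>" .
  have "cmod (\<psi> x - \<psi> y) \<le> (d x y / (1 + d x0 x)) powr \<beta> * (t * P_kernel d M \<gamma> x0 x 1)"
    using t(1) True by (simp add: test_bound_def mult_ac)
  also have "\<dots> \<le> (8 * A0\<^sup>2 * r powr \<alpha>) * (t * (1 / V x0 1))"
    using * t(2) P_kernel_le[of 1 \<gamma> x0 x] P_kernel_pos[of 1 \<gamma> x0 x] \<open>0 < \<gamma>\<close>
    by (intro mult_mono mult_left_mono) (auto intro!: mult_nonneg_nonneg)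
  finally show ?thesis by simp
next
  case False
  \<comment> \<open>The failed closeness condition and the diameter bound \<open>2 * A0 * r\<close>
    force \<open>4 * A0\<^sup>2 * r\<close> above 1. Doubling this pays for the two uniform bounds
    and fixes the constant \<open>8 * A0\<^sup>2\<close>.\<close>
  have "1 / (2 * A0) \<le> (1 + d x0 x) / (2 * A0)"
    using A0_ge_1 d_nonneg[of x0 x] by (intro divide_right_mono) auto
  also have "\<dots> < 2 * A0 * r" using False dist_qball_less[OF xy] by simp
  finally have "1 \<le> 4 * A0\<^sup>2 * r" using A0_ge_1 by (simp add: field_simps power2_eq_square)
  also have "\<dots> \<le> 4 * A0\<^sup>2 * r powr \<alpha>"
    using powr_mono'[of \<alpha> 1 r] \<alpha> r by (intro mult_left_mono) auto
  finally have "2 \<le> 8 * A0\<^sup>2 * r powr \<alpha>" by linarith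
  then have "2 * (t / V x0 1) \<le> 8 * A0\<^sup>2 * r powr \<alpha> * (t / V x0 1)"
    by (rule mult_right_mono) (use t in simp)
  moreover have "cmod (\<psi> x - \<psi> y) \<le> cmod (\<psi> x) + cmod (\<psi> y)" by (rule norm_triangle_ineq4)
  ultimately show ?thesis
    using test_bound_sup[OF t \<open>0 < \<gamma>\<close>, of x] test_bound_sup[OF t \<open>0 < \<gamma>\<close>, of y] by simp
qed

section \<open>The Lipschitz norm of a product\<close>

lemma lip_norm_mult_le:
  assumes f: "f \<in> borel_measurable M" "lip_norm d M \<theta> f < \<infinity>"
    and \<psi>: "\<psi> \<in> borel_measurable M"
    and t: "test_bound d A0 M x0 1 \<beta> \<gamma> \<psi> t" "0 \<le> t" and "0 < \<gamma>"
    and \<theta>: "0 < \<theta>" "\<theta> * \<omega> \<le> \<beta>" and "\<beta> \<le> 1"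
  shows "lip_norm d M \<theta> (\<lambda>x. \<psi> x * f x) \<le>
    ennreal ((1 + (1 + D powr \<theta>) * D powr \<theta> * (2 * A0) powr (\<theta> * \<omega>) * (8 * A0\<^sup>2)) / V x0 1
      * t * enn2real (lip_norm d M \<theta> f))" (is "_ \<le> ennreal ?R")
proof -
  define N where "N = enn2real (lip_norm d M \<theta> f)"
  define \<alpha> where "\<alpha> = \<theta> * \<omega>"
  define b where "b = t / V x0 1"
  \<comment> \<open>The factors come in turn from the pointwise bound on \<open>f\<close>, from
    comparing \<open>V y 1\<close> with \<open>V z r\<close>, and from the oscillation of
    \<open>\<psi>\<close>. The 1 in \<open>1 + K\<close> belongs to the term containing
    \<open>f x - f y\<close>.\<close>
  define K where "K = (1 + D powr \<theta>) * D powr \<theta> * (2 * A0) powr \<alpha> * (8 * A0\<^sup>2)"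
  have N: "0 \<le> N" and b: "0 \<le> b" and K: "0 \<le> K"
    using t A0_ge_1 by (auto simp: N_def b_def K_def)
  have R: "?R = (1 + K) * b * N" by (simp add: N_def b_def K_def \<alpha>_def)
  have \<alpha>: "0 \<le> \<alpha>" "\<alpha> \<le> \<beta>" using \<theta> upper_dimension_nonneg by (auto simp: \<alpha>_def)
  have \<psi>_le: "cmod (\<psi> x) \<le> b" for x unfolding b_def by (rule test_bound_sup[OF t \<open>0 < \<gamma>\<close>])
  have "lip_norm d M \<theta> (\<lambda>x. \<psi> x * f x) \<le> ennreal ((1 + K) * b * N)"
  proof (rule lip_norm_leI)
    show "(\<lambda>x. \<psi> x * f x) \<in> borel_measurable M" using f \<psi> by simp
    show "0 \<le> (1 + K) * b * N" using N b K by simp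
  next
    fix z x y and r :: real
    assume r: "0 < r" "r \<le> 1" and xy: "x \<in> qball d z r" "y \<in> qball d z r"
    have "V y 1 powr \<theta> \<le> (D * (2 * A0 / r) powr \<omega> * V z r) powr \<theta>"
      using V_unit_le[OF r xy(2)] \<theta> by (intro powr_mono2) auto
    also have "\<dots> = D powr \<theta> * (2 * A0 / r) powr \<alpha> * V z r powr \<theta>"
      using D_ge_1 by (simp add: powr_mult powr_powr \<alpha>_def mult.commute)
    also have "(2 * A0 / r) powr \<alpha> = (2 * A0) powr \<alpha> / r powr \<alpha>"
      using A0_ge_1 r by (simp add: powr_divide)
    finally have Vy: "V y 1 powr \<theta> \<le> D powr \<theta> * ((2 * A0) powr \<alpha> / r powr \<alpha>) * V z r powr \<theta>" .
    have "cmod (f y) \<le> (1 + D powr \<theta>) * N * V y 1 powr \<theta>"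
      unfolding N_def using f \<theta> by (intro lip_pointwise_bound)
    also have "\<dots> \<le> (1 + D powr \<theta>) * N * (D powr \<theta> * ((2 * A0) powr \<alpha> / r powr \<alpha>) * V z r powr \<theta>)"
      using Vy N by (intro mult_left_mono) auto
    finally have fy: "cmod (f y) \<le> \<dots>" .
    have "cmod (f y) * cmod (\<psi> x - \<psi> y) \<le>
        (1 + D powr \<theta>) * N * (D powr \<theta> * ((2 * A0) powr \<alpha> / r powr \<alpha>) * V z r powr \<theta>)
        * (8 * A0\<^sup>2 * r powr \<alpha> * b)"
      using fy test_bound_oscillation[OF t \<open>0 < \<gamma>\<close> \<alpha> \<open>\<beta> \<le> 1\<close> r xy] N
      by (intro mult_mono) (auto simp: b_def intro!: mult_nonneg_nonneg)
    \<comment> \<open>Here \<open>r powr \<alpha>\<close> from the oscillation of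
      \<open>\<psi>\<close> cancels the loss in the bound on \<open>f y\<close>.\<close>
    also have "\<dots> = K * b * N * V z r powr \<theta>"
      using r by (simp add: K_def)
    finally have second: "cmod (f y) * cmod (\<psi> x - \<psi> y) \<le> K * b * N * V z r powr \<theta>" .
    have first: "cmod (\<psi> x) * cmod (f x - f y) \<le> b * (N * V z r powr \<theta>)"
      using \<psi>_le lip_oscillation[OF f(2) r xy] b by (intro mult_mono) (auto simp: N_def)
    have "\<psi> x * f x - \<psi> y * f y = \<psi> x * (f x - f y) + f y * (\<psi> x - \<psi> y)"
      by (simp add: algebra_simps)
    then have "cmod (\<psi> x * f x - \<psi> y * f y) \<le>
        cmod (\<psi> x) * cmod (f x - f y) + cmod (f y) * cmod (\<psi> x - \<psi> y)"
      by (metis norm_triangle_ineq norm_mult)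
    then show "cmod (\<psi> x * f x - \<psi> y * f y) \<le> (1 + K) * b * N * V z r powr \<theta>"
      using first second by (simp add: algebra_simps)
  next
    \<comment> \<open>On large balls only size matters: \<open>b\<close> bounds
      \<open>\<psi>\<close> everywhere, so \<open>b * N\<close> already suffices and the term with
      \<open>K\<close> is slack.\<close>
    fix z and r :: real assume "1 < r"
    from lip_AE_bound[OF f(2) this, of z]
    show "AE x in M. x \<in> qball d z r \<longrightarrow> cmod (\<psi> x * f x) \<le> (1 + K) * b * N * V z r powr \<theta>"
    proof (rule eventually_mono, intro impI)
      fix x assume "x \<in> qball d z r \<longrightarrow> cmod (f x) \<le> enn2real (lip_norm d M \<theta> f) * V z r powr \<theta>"
        and "x \<in> qball d z r"
      then have "cmod (\<psi> x) * cmod (f x) \<le> b * (N * V z r powr \<theta>)"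
        using \<psi>_le b by (intro mult_mono) (auto simp: N_def)
      moreover have "0 \<le> K * b * N * V z r powr \<theta>" using K b N by simp
      ultimately show "cmod (\<psi> x * f x) \<le> (1 + K) * b * N * V z r powr \<theta>"
        by (simp add: norm_mult algebra_simps)
    qed
  qed
  then show ?thesis unfolding R .
qed

end

theorem proposition2p8:
  fixes d :: "'a \<Rightarrow> 'a \<Rightarrow> real" and A0 :: real and M :: "'a measure"
    and x0 :: 'a and \<theta> \<beta> \<gamma> :: real
  assumes "homogeneous_type_space d A0 M"
    and "0 < \<theta>" and "\<theta> \<le> 1 / upper_dimension d M"
    and "\<theta> * upper_dimension d M \<le> \<beta>" and "\<beta> \<le> 1"
    and "0 < \<gamma>"
  shows "\<exists>C>0. \<forall>q\<ge>1. \<forall>\<psi> \<in> test_space d A0 M x0 1 \<beta> \<gamma>. \<forall>f \<in> lip_space d M q \<theta>.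
    (\<lambda>x. \<psi> x * f x) \<in> lip_space d M q \<theta> \<and>
    lip_norm d M \<theta> (\<lambda>x. \<psi> x * f x)
      \<le> ennreal (C * test_norm d A0 M x0 1 \<beta> \<gamma> \<psi>) * lip_norm d M \<theta> f"
proof -
  interpret homogeneous_type_space d A0 M by fact
  \<comment> \<open>Chosen before \<open>q\<close>, \<open>\<psi>\<close> and \<open>f\<close>,
    hence uniform in all three.\<close>
  define C where "C = (1 + (1 + D powr \<theta>) * D powr \<theta> * (2 * A0) powr (\<theta> * \<omega>) * (8 * A0\<^sup>2)) / V x0 1"
  have C: "0 < C"
    unfolding C_def using V_pos[of 1 x0]
    by (intro divide_pos_pos add_pos_nonneg mult_nonneg_nonneg) auto
  show ?thesis
  proof (intro exI[of _ C] conjI C allI impI ballI)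
    fix q \<psi> f
    assume \<psi>: "\<psi> \<in> test_space d A0 M x0 1 \<beta> \<gamma>" and f: "f \<in> lip_space d M q \<theta>"
    let ?t = "test_norm d A0 M x0 1 \<beta> \<gamma> \<psi>"
    note t = test_norm_bound[OF \<psi>]
    have \<psi>m: "\<psi> \<in> borel_measurable M" using \<psi> by (simp add: test_space_def)
    have fL: "f \<in> Lq_ball_space d M q" and fin: "lip_norm d M \<theta> f < \<infinity>"
      using f by (auto simp: lip_space_def)
    have fm: "f \<in> borel_measurable M" using fL by (simp add: Lq_ball_space_def)
    have "lip_norm d M \<theta> (\<lambda>x. \<psi> x * f x) \<le> ennreal (C * ?t * enn2real (lip_norm d M \<theta> f))"
      unfolding C_def by (rule lip_norm_mult_le[OF fm fin \<psi>m t \<open>0 < \<gamma>\<close> assms(2,4,5)])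
    also have "\<dots> = ennreal (C * ?t) * lip_norm d M \<theta> f"
      using C t(2) fin by (simp add: ennreal_mult)
    finally show le: "lip_norm d M \<theta> (\<lambda>x. \<psi> x * f x) \<le> ennreal (C * ?t) * lip_norm d M \<theta> f" .
    \<comment> \<open>The norm estimate itself gives the finiteness required for membership in
      \<open>lip_space\<close>.\<close>
    also have "\<dots> < \<infinity>" using fin by (simp add: ennreal_mult_less_top)
    finally show "(\<lambda>x. \<psi> x * f x) \<in> lip_space d M q \<theta>"
      using Lq_ball_space_mult_bounded[OF fL \<psi>m test_bound_sup[OF t \<open>0 < \<gamma>\<close>]]
      by (simp add: lip_space_def)
  qed
qed

end
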